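(* Assume (a) there is a normal super $(\lambda,J)$-sequence $\bar\eta$ for $\bar I=\langle I_i:i<\delta\rangle$; (b) for each $i<\delta$, $I_i=\mathrm{ERI}^2_{\lambda_i,\kappa_i}$, that is, the ideal of all $X\subseteq[\lambda_i]^2$ such that for some $h:X\to\kappa_i$ with $|\mathrm{Rang}(h)|<\kappa_i$, there is no $u\in[\lambda_i]^{\aleph_0}$ with $[u]^2\subseteq X$ and $h\restriction[u]^2$ constant; (c) $\delta<\omega_1$. Then $\lambda$ is not a free caliber of $\prod_{i<\delta}\mathrm{FBA}(\lambda_i)$.
   Context: $\mathrm{FBA}(\beta)$ is the Boolean algebra freely generated by $\langle x_\alpha:\alpha<\beta\rangle$; products are full direct products. A subset $Y$ of a Boolean algebra is independent if $\bigcap_{y\in u}y\cap\bigcap_{y\in v}(-y)\neq0$ for all disjoint finite $u,v\subseteq Y$. $\lambda$ is a free caliber of a Boolean algebra $\mathbf B$ if every $X\subseteq\mathbf B$ of cardinality $\lambda$ has an independent subset of cardinality $\lambda$. Ideals are proper; $I^+=\{A\subseteq\mathrm{Dom}(I):A\notin I\}$; $\mathrm{comp}(I)$ is the maximal $\kappa$ such that $I$ is $\kappa$-complete (closed under unions of $<\kappa$ members). For ideals $J_\ell$ ($\ell<n$), $\prod_{\ell<n}J_\ell$ is the ideal on $\prod_{\ell<n}\mathrm{Dom}(J_\ell)$ with $X\in(\prod_{\ell<n}J_\ell)^+$ iff $(\exists^{J_0^+}x_0)\cdots(\exists^{J_{n-1}^+}x_{n-1})\,\langle x_0,\dots,x_{n-1}\rangle\in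 X$, where $(\exists^{J^+}x)\varphi(x)$ means $\{x:\varphi(x)\}\in J^+$. Let $J$ be an ideal on $\delta$ and let $I_i$ be ideals for $i<\delta$. $\bar\eta=\langle\eta_\alpha:\alpha<\lambda\rangle$ is a $(\lambda,J)$-sequence for $\bar I$ if $\eta_\alpha\in\prod_{i<\delta}\mathrm{Dom}(I_i)$ and for every unbounded $X\subseteq\lambda$, $\{i<\delta:\{\eta_\alpha(i):\alpha\in X\}\in I_i\}\in J$. It is normal if $\mathrm{comp}(I_i)>|\{\eta_\alpha\restriction i:\alpha<\lambda\}|$ for every $i<\delta$. It is super if in addition, for every $n<\omega$ and pairwise distinct $\beta_{\alpha,\ell}<\lambda$ ($\alpha<\lambda$, $\ell<n$) with $\beta_{\alpha,\ell}$ increasing in $\ell$: (i) $\{i<\delta:\{\langle\eta_{\beta_{\alpha,\ell}}(i):\ell<n\rangle:\alpha<\lambda\}\in\prod_{\ell<n}I_i\}\in J$; and moreover (ii) for some $A\in J$, for all $m<\omega$ and all $i_0<\dots<i_{m-1}$ in $\delta\setminus A$, $\{\langle\langle\eta_{\beta_{\alpha,\ell}}(i_t):\ell<n\rangle:t<m\rangle:\alpha<\lambda\}\in\big(\prod_{t<m}\big(\prod_{\ell<n}I_{i_t}\big)\big)^+$. *)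

theory Defs
  imports "HOL-Library.Ramsey"
begin

unbundle cardinal_syntax

text \<open>
  Cardinals are relations \<open>r\<close> with \<^term>\<open>Card_order r\<close>; the ordinals below the cardinal are the
  elements of \<^term>\<open>Field r\<close>, and \<open>(a, b) \<in> r\<close> means \<open>a \<le> b\<close>.  The ordinal \<open>\<delta>\<close> is a type of class
  \<^class>\<open>wellorder\<close>, so that \<open>\<delta>\<close>-sequences are functions on that type.  This covers every
  \<open>\<delta> \<noteq> 0\<close>; on \<open>\<delta> = 0\<close> there are no proper ideals.
\<close>

text \<open>
  A Boolean algebra is a subset of a type of class \<^class>\<open>boolean_algebra\<close> that is closed under
  the operations of the type.
\<close>

definition is_subalgebra :: "'b::boolean_algebra set \<Rightarrow> bool" where
  "is_subalgebra B \<longleftrightarrow>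
     bot \<in> B \<and> top \<in> B \<and> (\<forall>x\<in>B. - x \<in> B) \<and> (\<forall>x\<in>B. \<forall>y\<in>B. inf x y \<in> B \<and> sup x y \<in> B)"

text \<open>Inserting \<^const>\<open>top\<close> makes the empty meet \<open>1\<close>.\<close>

definition BA_independent :: "'b::boolean_algebra set \<Rightarrow> bool" where
  "BA_independent Y \<longleftrightarrow>
     (\<forall>u v. finite u \<and> finite v \<and> u \<subseteq> Y \<and> v \<subseteq> Y \<and> u \<inter> v = {} \<longrightarrow>
        Inf_fin (insert top (u \<union> uminus ` v)) \<noteq> bot)"

definition free_caliber :: "'l rel \<Rightarrow> 'b::boolean_algebra set \<Rightarrow> bool" where
  "free_caliber lam B \<longleftrightarrow>
     (\<forall>X. X \<subseteq> B \<and> |X| =o lam \<longrightarrow> (\<exists>Y. Y \<subseteq> X \<and> |Y| =o lam \<and> BA_independent Y))"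

definition BA_prod :: "('d \<Rightarrow> 'b::boolean_algebra set) \<Rightarrow> ('d \<Rightarrow> 'b) set" where
  "BA_prod B = {f. \<forall>i. f i \<in> B i}"

lemma is_subalgebra_BA_prod: "(\<And>i. is_subalgebra (B i)) \<Longrightarrow> is_subalgebra (BA_prod B)"
  by (auto simp: is_subalgebra_def BA_prod_def)

text \<open>
  The free Boolean algebra on generators \<open>x\<^sub>a\<close>, \<open>a \<in> S\<close>, is realised as an algebra of sets: points
  are truth assignments (given by the set \<open>V\<close> of true variables), and \<open>x\<^sub>a = {V. a \<in> V}\<close>.  That it is
  freely generated is the universal property \<open>FBA_universal\<close> below.
\<close>

definition FBA_gen :: "'p \<Rightarrow> 'p set set" where
  "FBA_gen a = {V. a \<in> V}"

inductive_set FBA_on :: "'p set \<Rightarrow> 'p set set set" for S :: "'p set" where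
  gen: "a \<in> S \<Longrightarrow> FBA_gen a \<in> FBA_on S"
| top: "UNIV \<in> FBA_on S"
| compl: "A \<in> FBA_on S \<Longrightarrow> - A \<in> FBA_on S"
| inter: "A \<in> FBA_on S \<Longrightarrow> B \<in> FBA_on S \<Longrightarrow> A \<inter> B \<in> FBA_on S"

definition FBA :: "'p rel \<Rightarrow> 'p set set set" where
  "FBA r = FBA_on (Field r)"

lemma is_subalgebra_FBA_on: "is_subalgebra (FBA_on S)"
proof -
  have "{} \<in> FBA_on S" using FBA_on.compl[OF FBA_on.top] by simp
  moreover have "A \<union> B \<in> FBA_on S" if "A \<in> FBA_on S" "B \<in> FBA_on S" for A B
    using FBA_on.compl[OF FBA_on.inter[OF FBA_on.compl[OF that(1)] FBA_on.compl[OF that(2)]]]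
    by simp
  ultimately show ?thesis
    by (auto simp: is_subalgebra_def intro: FBA_on.intros)
qed

definition is_BA_hom :: "'a::boolean_algebra set \<Rightarrow> ('a \<Rightarrow> 'b::boolean_algebra) \<Rightarrow> bool" where
  "is_BA_hom B h \<longleftrightarrow>
     h top = top \<and> (\<forall>x\<in>B. h (- x) = - h x) \<and> (\<forall>x\<in>B. \<forall>y\<in>B. h (inf x y) = inf (h x) (h y))"

inductive FBA_rel :: "'p set \<Rightarrow> ('p \<Rightarrow> 'b::boolean_algebra) \<Rightarrow> 'p set set \<Rightarrow> 'b \<Rightarrow> bool"
  for S g where
  gen: "a \<in> S \<Longrightarrow> FBA_rel S g (FBA_gen a) (g a)"
| top: "FBA_rel S g UNIV top"
| compl: "FBA_rel S g A b \<Longrightarrow> FBA_rel S g (- A) (- b)"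
| inter: "FBA_rel S g A b \<Longrightarrow> FBA_rel S g B c \<Longrightarrow> FBA_rel S g (A \<inter> B) (inf b c)"

definition minterm :: "('p \<Rightarrow> 'b::boolean_algebra) \<Rightarrow> 'p set \<Rightarrow> 'p set \<Rightarrow> 'b" where
  "minterm g F V = Inf_fin (insert top ((\<lambda>a. if a \<in> V then g a else - g a) ` F))"

lemma minterm_insert:
  "finite F \<Longrightarrow> minterm g (insert a F) V = inf (if a \<in> V then g a else - g a) (minterm g F V)"
  unfolding minterm_def image_insert
  by (subst insert_commute, subst Inf_fin.insert) auto

lemma minterm_antimono: "finite G \<Longrightarrow> F \<subseteq> G \<Longrightarrow> minterm g G V \<le> minterm g F V"
  unfolding minterm_def by (rule Inf_fin.subset_imp) auto

lemma minterm_cover: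
  assumes "finite F" "\<And>V. minterm g F V \<le> c"
  shows "c = top"
  using assms
proof (induction F arbitrary: c rule: finite_induct)
  case empty
  then show ?case by (simp add: minterm_def top.extremum_unique)
next
  case (insert a F)
  have "minterm g F V \<le> c" for V
  proof -
    have eq: "minterm g F (V - {a}) = minterm g F V" "minterm g F (V \<union> {a}) = minterm g F V"
      using insert.hyps(2) unfolding minterm_def
      by (auto intro!: arg_cong[where f = "\<lambda>X. Inf_fin (insert top X)"] image_cong)
    have "inf (- g a) (minterm g F V) \<le> c" "inf (g a) (minterm g F V) \<le> c"
      using insert.prems[of "V - {a}"] insert.prems[of "V \<union> {a}"] eq
      by (auto simp: minterm_insert insert.hyps(1))
    then have "sup (inf (g a) (minterm g F V)) (inf (- g a) (minterm g F V)) \<le> c"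
      by simp
    then show ?thesis
      by (simp flip: inf_sup_distrib2)
  qed
  then show ?case by (rule insert.IH)
qed

lemma FBA_rel_minterm:
  assumes "FBA_rel S g A b"
  shows "\<exists>F. finite F \<and> (\<forall>V. minterm g F V \<le> (if V \<in> A then b else - b))"
  using assms
proof induction
  case (gen a)
  show ?case by (rule exI[of _ "{a}"]) (auto simp: minterm_def FBA_gen_def Inf_fin.insert)
next
  case top
  show ?case by (rule exI[of _ "{}"]) (simp add: minterm_def)
next
  case (compl A b)
  then show ?case by (auto split: if_splits)
next
  case (inter A b B c)
  then obtain F G where F: "finite F" "\<And>V. minterm g F V \<le> (if V \<in> A then b else - b)"
    and G: "finite G" "\<And>V. minterm g G V \<le> (if V \<in> B then c else - c)" by blast
  have "minterm g (F \<union> G) V \<le> (if V \<in> A \<inter> B then inf b c else - inf b c)" for V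
  proof -
    have "minterm g (F \<union> G) V \<le> (if V \<in> A then b else - b)"
      using F minterm_antimono[of "F \<union> G" F g V] G(1) by (meson finite_UnI order_trans sup_ge1)
    moreover have "minterm g (F \<union> G) V \<le> (if V \<in> B then c else - c)"
      using G minterm_antimono[of "F \<union> G" G g V] F(1) by (meson finite_UnI order_trans sup_ge2)
    ultimately show ?thesis
      by (auto split: if_splits intro: le_supI1 le_supI2)
  qed
  then show ?case using F(1) G(1) by (meson finite_UnI)
qed

lemma FBA_rel_unique:
  assumes "FBA_rel S g A b" "FBA_rel S g A c"
  shows "b = c"
proof -
  have *: "inf b (- c) = bot" if "FBA_rel S g A b" "FBA_rel S g A c" for b c
  proof -
    have "FBA_rel S g {} (inf b (- c))"
      using FBA_rel.inter[OF that(1) FBA_rel.compl[OF that(2)]] by simp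
    from FBA_rel_minterm[OF this] have "- inf b (- c) = top"
      using minterm_cover by (metis empty_iff)
    then show ?thesis by (metis boolean_algebra.compl_one double_compl)
  qed
  have "b \<le> c" "c \<le> b"
    using *[OF assms] *[OF assms(2,1)] by (simp_all add: inf_shunt)
  then show ?thesis by simp
qed

theorem FBA_universal:
  fixes g :: "'p \<Rightarrow> 'b::boolean_algebra"
  shows "\<exists>h. is_BA_hom (FBA_on S) h \<and> (\<forall>a\<in>S. h (FBA_gen a) = g a) \<and>
    (\<forall>h'. is_BA_hom (FBA_on S) h' \<and> (\<forall>a\<in>S. h' (FBA_gen a) = g a) \<longrightarrow> (\<forall>A\<in>FBA_on S. h' A = h A))"
proof -
  define h where "h A = (THE b. FBA_rel S g A b)" for A
  have ex: "\<exists>b. FBA_rel S g A b" if "A \<in> FBA_on S" for A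
    using that by induction (blast intro: FBA_rel.intros)+
  have eq: "h A = b" if "FBA_rel S g A b" for A b
    unfolding h_def using that FBA_rel_unique by blast
  have hom: "is_BA_hom (FBA_on S) h"
    unfolding is_BA_hom_def
  proof (intro conjI ballI)
    show "h top = top" by (rule eq[OF FBA_rel.top])
  next
    fix x assume "x \<in> FBA_on S"
    then show "h (- x) = - h x" using ex eq FBA_rel.compl by metis
  next
    fix x y assume "x \<in> FBA_on S" "y \<in> FBA_on S"
    then show "h (inf x y) = inf (h x) (h y)" using ex eq FBA_rel.inter by metis
  qed
  have gen: "\<forall>a\<in>S. h (FBA_gen a) = g a" using eq FBA_rel.gen by metis
  have "h' A = h A" if h': "is_BA_hom (FBA_on S) h'" "\<forall>a\<in>S. h' (FBA_gen a) = g a"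
    and "A \<in> FBA_on S" for h' A
    using that(3)
    by induction (use h' hom gen in \<open>auto simp: is_BA_hom_def\<close>)
  then show ?thesis using hom gen by blast
qed

text \<open>An ideal is a pair of its domain and its family of members.\<close>

type_synonym 'a idl = "'a set \<times> 'a set set"

definition Dom :: "'a idl \<Rightarrow> 'a set" where "Dom I = fst I"

definition members :: "'a idl \<Rightarrow> 'a set set" where "members I = snd I"

definition is_ideal :: "'a idl \<Rightarrow> bool" where
  "is_ideal I \<longleftrightarrow>
     members I \<subseteq> Pow (Dom I) \<and> {} \<in> members I \<and> Dom I \<notin> members I \<and>
     (\<forall>A\<in>members I. \<forall>B. B \<subseteq> A \<longrightarrow> B \<in> members I) \<and>
     (\<forall>A\<in>members I. \<forall>B\<in>members I. A \<union> B \<in> members I)"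

definition positive :: "'a idl \<Rightarrow> 'a set set" where
  "positive I = {A. A \<subseteq> Dom I \<and> A \<notin> members I}"

definition kappa_complete :: "'c rel \<Rightarrow> 'a idl \<Rightarrow> bool" where
  "kappa_complete kap I \<longleftrightarrow> (\<forall>F. F \<subseteq> members I \<and> |F| <o kap \<longrightarrow> \<Union>F \<in> members I)"

text \<open>
  \<open>is_comp I kap\<close>: \<open>kap\<close> is the largest cardinal for which \<open>I\<close> is complete.  The bound variable
  \<open>kap'\<close> has the type of \<^term>\<open>cardSuc kap\<close>, which makes \<open>kap\<close> largest among the cardinals of all
  types (\<open>is_comp_greatest\<close>).  No largest one exists if \<open>I\<close> is closed under arbitrary unions;
  otherwise there is one (\<open>ex_is_comp\<close>).
\<close>

definition is_comp :: "'a idl \<Rightarrow> 'a set rel \<Rightarrow> bool" where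
  "is_comp I kap \<longleftrightarrow>
     Card_order kap \<and> kappa_complete kap I \<and>
     (\<forall>kap' :: 'a set set rel. Card_order kap' \<and> kappa_complete kap' I \<longrightarrow> kap' \<le>o kap)"

lemma kappa_complete_mono: "kappa_complete kap' I \<Longrightarrow> kap \<le>o kap' \<Longrightarrow> kappa_complete kap I"
  unfolding kappa_complete_def by (meson ordLess_ordLeq_trans)

lemma is_comp_greatest:
  assumes "is_comp I kap" "Card_order kap'" "kappa_complete kap' I"
  shows "kap' \<le>o kap"
proof (rule ccontr)
  have kap: "Card_order kap" using assms(1) by (simp add: is_comp_def)
  assume "\<not> ?thesis"
  then have "kap <o kap'"
    using kap assms(2) by (simp add: not_ordLeq_iff_ordLess card_order_on_well_order_on)
  then have "cardSuc kap \<le>o kap'" using kap assms(2) by (simp add: cardSuc_least)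
  then have "kappa_complete (cardSuc kap) I" using assms(3) by (rule kappa_complete_mono[rotated])
  then have "cardSuc kap \<le>o kap"
    using assms(1) kap by (simp add: is_comp_def cardSuc_Card_order)
  then show False using cardSuc_greater[OF kap] not_ordLess_ordLeq by blast
qed

lemma ex_is_comp:
  assumes "F0 \<subseteq> members I" "\<Union>F0 \<notin> members I"
  shows "\<exists>kap. is_comp I kap"
proof -
  let ?R = "{|F| | F. F \<subseteq> members I \<and> \<Union>F \<notin> members I}"
  have "\<exists>r\<in>?R. \<forall>r'\<in>?R. r \<le>o r'"
    by (rule exists_minim_Card_order) (use assms in \<open>auto simp: card_of_Card_order\<close>)
  then obtain F where F: "F \<subseteq> members I" "\<Union>F \<notin> members I"
    and min: "\<And>G. G \<subseteq> members I \<Longrightarrow> \<Union>G \<notin> members I \<Longrightarrow> |F| \<le>o |G|" by blast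
  have "kappa_complete |F| I"
    unfolding kappa_complete_def using min not_ordLess_ordLeq by blast
  moreover have "kap' \<le>o |F|" if "Card_order kap'" "kappa_complete kap' I"
    for kap' :: "'a set set rel"
  proof -
    have "\<not> |F| <o kap'" using that(2) F by (auto simp: kappa_complete_def)
    then show ?thesis
      using that(1) not_ordLess_iff_ordLeq[of kap' "|F|"] card_of_Well_order
      by (auto simp: card_order_on_well_order_on)
  qed
  ultimately show ?thesis
    using card_of_Card_order by (auto simp: is_comp_def)
qed

text \<open>
  Tuples are lists, and \<open>prod_ideal Js\<close> is the product of the list \<open>Js\<close> of ideals, so
  \<open>prod_ideal (replicate n J)\<close> is \<open>\<Prod>\<^bsub>\<ell><n\<^esub> J\<close>.
\<close>

primrec ex_pos :: "'a idl list \<Rightarrow> 'a list set \<Rightarrow> bool" where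
  "ex_pos [] X \<longleftrightarrow> [] \<in> X"
| "ex_pos (J # Js) X \<longleftrightarrow> {x \<in> Dom J. ex_pos Js {xs. x # xs \<in> X}} \<in> positive J"

definition prod_ideal :: "'a idl list \<Rightarrow> 'a list idl" where
  "prod_ideal Js =
     (listset (map Dom Js), {X. X \<subseteq> listset (map Dom Js) \<and> \<not> ex_pos Js X})"

definition ERI2 :: "'p rel \<Rightarrow> 'k rel \<Rightarrow> 'p set idl" where
  "ERI2 lam kap =
     (nsets (Field lam) 2,
      {X. X \<subseteq> nsets (Field lam) 2 \<and>
          (\<exists>h. h \<in> X \<rightarrow> Field kap \<and> |h ` X| <o kap \<and>
               \<not> (\<exists>u. u \<subseteq> Field lam \<and> |u| =o natLeq \<and> nsets u 2 \<subseteq> X \<and>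
                      (\<exists>c. \<forall>p\<in>nsets u 2. h p = c)))})"

definition unbounded_in :: "'l rel \<Rightarrow> 'l set \<Rightarrow> bool" where
  "unbounded_in lam X \<longleftrightarrow> X \<subseteq> Field lam \<and> (\<forall>a\<in>Field lam. \<exists>b\<in>X. (a, b) \<in> lam)"

definition J_sequence ::
  "'l rel \<Rightarrow> 'd::wellorder idl \<Rightarrow> ('d \<Rightarrow> 'a idl) \<Rightarrow> ('l \<Rightarrow> 'd \<Rightarrow> 'a) \<Rightarrow> bool" where
  "J_sequence lam J I eta \<longleftrightarrow>
     is_ideal J \<and> Dom J = UNIV \<and> (\<forall>i. is_ideal (I i)) \<and>
     (\<forall>a\<in>Field lam. \<forall>i. eta a i \<in> Dom (I i)) \<and>
     (\<forall>X. unbounded_in lam X \<longrightarrow> {i. {eta a i | a. a \<in> X} \<in> members (I i)} \<in> members J)"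

definition normal_sequence ::
  "'l rel \<Rightarrow> ('d::wellorder \<Rightarrow> 'a idl) \<Rightarrow> ('l \<Rightarrow> 'd \<Rightarrow> 'a) \<Rightarrow> bool" where
  "normal_sequence lam I eta \<longleftrightarrow>
     (\<forall>i. \<exists>kap. is_comp (I i) kap \<and> |{restrict (eta a) {..<i} | a. a \<in> Field lam}| <o kap)"

definition super_sequence ::
  "'l rel \<Rightarrow> 'd::wellorder idl \<Rightarrow> ('d \<Rightarrow> 'a idl) \<Rightarrow> ('l \<Rightarrow> 'd \<Rightarrow> 'a) \<Rightarrow> bool" where
  "super_sequence lam J I eta \<longleftrightarrow>
     (\<forall>(n::nat) (b :: 'l \<Rightarrow> nat \<Rightarrow> 'l).
        (\<forall>a\<in>Field lam. \<forall>l<n. b a l \<in> Field lam) \<and>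
        inj_on (\<lambda>(a, l). b a l) (Field lam \<times> {..<n}) \<and>
        (\<forall>a\<in>Field lam. \<forall>l l'. l < l' \<and> l' < n \<longrightarrow> (b a l, b a l') \<in> lam \<and> b a l \<noteq> b a l') \<longrightarrow>
        {i. {map (\<lambda>l. eta (b a l) i) [0..<n] | a. a \<in> Field lam}
              \<in> members (prod_ideal (replicate n (I i)))} \<in> members J \<and>
        (\<exists>A\<in>members J. \<forall>is. sorted_wrt (<) is \<and> set is \<inter> A = {} \<longrightarrow>
           {map (\<lambda>i. map (\<lambda>l. eta (b a l) i) [0..<n]) is | a. a \<in> Field lam}
             \<in> positive (prod_ideal (map (\<lambda>i. prod_ideal (replicate n (I i))) is))))"

end

theory Submission
  imports Defs
begin

text \<open>
  Read \<open>\<eta>\<^sub>\<alpha>(i)\<close> as an edge of the complete graph on \<open>\<lambda>\<^sub>i\<close>.  Enumerate \<open>\<delta>\<close> by an injection \<open>code\<close> into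
  the natural numbers; this is the use of \<open>\<delta> < \<omega>\<^sub>1\<close>, and it gives each coordinate \<open>i\<close> the finite set
  \<open>W\<^sub>i\<close> of all \<open>k \<le> i\<close> with \<open>code k \<le> code i\<close>.  By normality the vertices occurring in the edges
  \<open>\<eta>\<^sub>\<alpha>(k)\<close>, \<open>k \<le> i\<close>, can be coded by elements of \<open>\<lambda>\<^sub>i\<close> (\<open>ex_coding\<close>), so a truth assignment for the
  generators of \<open>FBA(\<lambda>\<^sub>i)\<close> colours the vertices at all levels \<open>k \<in> W\<^sub>i\<close> with two colours.  Let
  \<open>f\<^sub>\<alpha>(i)\<close> say: the first level of \<open>W\<^sub>i\<close> at which the edge \<open>\<eta>\<^sub>\<alpha>(k)\<close> is monochromatic exists, and its
  colour there is ``true'' (\<open>first_mono_true\<close>).  Since \<open>W\<^sub>i\<close> and the edges are finite, this is an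
  element of \<open>FBA(\<lambda>\<^sub>i)\<close>.

  No \<open>\<lambda>\<close> of these elements are independent.  Let \<open>X \<subseteq> \<lambda>\<close> have cardinality \<open>\<lambda>\<close>.  For
  \<open>J\<close>-almost all \<open>j\<close> the edges \<open>\<eta>\<^sub>\<alpha>(j)\<close>, \<open>\<alpha> \<in> X\<close>, form a positive set; by normality they still do so for
  the \<open>\<alpha>\<close> with one suitable fixed restriction \<open>\<eta>\<^sub>\<alpha> \<restriction> j\<close>, and a positive set contains an infinite complete
  graph, in particular one on four vertices \<open>a, b, c, d\<close>.  Ask that \<open>f\<^sub>\<alpha>\<close> be true for the edges \<open>ab\<close>
  and \<open>cd\<close> and false for the four others.  At a coordinate \<open>i\<close> with \<open>W\<^sub>i \<subseteq> j\<close> this fails because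
  all six elements agree.  If \<open>j \<in> W\<^sub>i\<close>, and the common levels below \<open>j\<close> have not already given all six
  the same value, then level \<open>j\<close> must not be constantly ``false'' on \<open>ab\<close>, nor on \<open>cd\<close>; so one end of
  each is true, and the edge joining these ends gets the value true.  (The graph with edges \<open>ab\<close>,
  \<open>cd\<close> is not split into a clique and an independent set.)  This is \<open>first_mono_true_cross_edge\<close>.

  One such pattern, at \<open>j\<^sub>0\<close>, excludes all coordinates but the finitely many \<open>i > j\<^sub>0\<close> with
  \<open>code i < code j\<^sub>0\<close>.  A second one, disjoint from it, at some \<open>j\<^sub>1\<close> not below any of these, excludes
  the rest, so together they contradict independence.  To find \<open>j\<^sub>1\<close>, the elements are made trivial
  outside the set \<open>D\<close> of all \<open>i\<close> whose initial segment belongs to \<open>J\<close>; \<open>D\<close> itself is not in \<open>J\<close>.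

  Finally there are \<open>\<lambda>\<close> different \<open>f\<^sub>\<alpha>\<close>.  Equality \<open>f\<^sub>\<alpha> = f\<^sub>\<beta>\<close> forces \<open>\<eta>\<^sub>\<alpha>\<close> and \<open>\<eta>\<^sub>\<beta>\<close> to agree on
  \<open>D\<close> (\<open>first_mono_true_separates\<close>); with fewer than \<open>\<lambda>\<close> values, \<open>\<lambda>\<close> disjoint pairs would have equal
  \<open>f\<close> (\<open>full_matching\<close>), and the super property for \<open>n = 2\<close> forbids this, since the diagonal of a
  product of ideals containing the singletons is small (\<open>super_sequence_no_repetition\<close>).
\<close>

section \<open>The ideals of edge sets\<close>

lemma infinite_nsets_2:
  assumes "infinite u"
  shows "infinite (nsets u 2)"
proof
  assume fin: "finite (nsets u 2)"
  obtain a where a: "a \<in> u" using assms by fastforce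
  have "(\<lambda>b. {a, b}) ` (u - {a}) \<subseteq> nsets u 2" using a by auto
  then have "finite ((\<lambda>b. {a, b}) ` (u - {a}))" using fin finite_subset by blast
  moreover have "inj_on (\<lambda>b. {a, b}) (u - {a})" by (rule inj_onI) auto
  ultimately show False using assms finite_imageD by fastforce
qed

text \<open>
  With at most one colour available below \<open>\<kappa>\<close>, only the empty set would belong to the ideal, which would
  then be complete for every cardinal and have no completeness number; normality, which supplies
  \<open>kap\<close>, rules this out.
\<close>

lemma ERI2_coloring_nontrivial:
  fixes L :: "'p rel" and K :: "'k rel"
  assumes K: "Card_order K" and ideal: "is_ideal (ERI2 L K)" and comp: "is_comp (ERI2 L K) kap"
  shows "|{()}| <o K"
proof (rule ccontr)
  assume "\<not> ?thesis"
  then have small: "K \<le>o |{()}|"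
    using K not_ordLess_iff_ordLeq[of K "|{()}|"] card_of_Well_order
    by (auto simp: card_order_on_well_order_on)
  have only_empty: "X = {}" if "X \<in> members (ERI2 L K)" for X
  proof -
    from that obtain h :: "'p set \<Rightarrow> 'k" where "|h ` X| <o K"
      unfolding ERI2_def members_def by auto
    then have less: "|h ` X| <o |{()}|" using small ordLess_ordLeq_trans by blast
    have "h ` X = {}"
    proof (rule ccontr)
      assume "h ` X \<noteq> {}"
      then have "|{()}| \<le>o |h ` X|" by (rule card_of_singl_ordLeq)
      then show False using less not_ordLess_ordLeq by blast
    qed
    then show ?thesis by simp
  qed
  have "{} \<in> members (ERI2 L K)" using ideal by (simp add: is_ideal_def)
  then have "kappa_complete kap' (ERI2 L K)" for kap' :: "'p set set set rel"
    using only_empty unfolding kappa_complete_def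
    by (metis (mono_tags, lifting) Union_empty_conv in_mono)
  moreover have ck: "Card_order kap" using comp by (simp add: is_comp_def)
  ultimately have "cardSuc kap \<le>o kap"
    using cardSuc_Card_order is_comp_greatest[OF comp] by blast
  then show False using cardSuc_greater[OF ck] not_ordLess_ordLeq by blast
qed

text \<open>The defining condition of the ideal, applied to a constant colouring.\<close>

lemma ERI2_large_contains_complete:
  assumes K: "|{()}| <o K" "Card_order K"
    and X: "X \<subseteq> nsets (Field L) 2" "X \<notin> members (ERI2 L K)"
  obtains u where "infinite u" "u \<subseteq> Field L" "nsets u 2 \<subseteq> X"
proof -
  have "|{()}| <o |Field K|"
    using K card_of_Field_ordIso ordIso_symmetric ordLess_ordIso_trans by blast
  then have "Field K \<noteq> {}" using card_of_empty not_ordLess_ordLeq by metis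
  then obtain c where c: "c \<in> Field K" by blast
  have "|(\<lambda>_. c) ` X| \<le>o |{()}|" by (rule surj_imp_ordLeq[where f = "\<lambda>_. c"]) auto
  then have "|(\<lambda>_. c) ` X| <o K" using K(1) ordLeq_ordLess_trans by blast
  moreover have "(\<lambda>_. c) \<in> X \<rightarrow> Field K" using c by simp
  moreover have "\<exists>u. u \<subseteq> Field L \<and> |u| =o natLeq \<and> nsets u 2 \<subseteq> X \<and> (\<exists>c. \<forall>p\<in>nsets u 2. h p = c)"
    if "h \<in> X \<rightarrow> Field K" "|h ` X| <o K" for h
    using X that by (simp add: ERI2_def members_def) metis
  ultimately obtain u where u: "u \<subseteq> Field L" "|u| =o natLeq" "nsets u 2 \<subseteq> X" by metis
  have "infinite u" using u(2) infinite_iff_natLeq_ordLeq ordIso_iff_ordLeq by blast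
  then show thesis using that u by blast
qed

lemma ERI2_singleton:
  assumes K: "|{()}| <o K" "Card_order K" and p: "p \<in> nsets (Field L) 2"
  shows "{p} \<in> members (ERI2 L K)"
proof (rule ccontr)
  assume "\<not> ?thesis"
  then obtain u where "infinite u" "nsets u 2 \<subseteq> {p}"
    by (rule ERI2_large_contains_complete[OF K, of "{p}" L, rotated]) (use p in auto)
  then show False using infinite_nsets_2 finite_subset by blast
qed

text \<open>Otherwise the domain, a union of singletons, would be a member.\<close>

lemma comp_ordLeq_Dom:
  assumes "is_ideal I" "is_comp I kap" and sing: "\<And>p. p \<in> Dom I \<Longrightarrow> {p} \<in> members I"
  shows "kap \<le>o |Dom I|"
proof (rule ccontr)
  assume "\<not> ?thesis"
  then have "|Dom I| <o kap"
    using assms(2) not_ordLeq_iff_ordLess[of "|Dom I|" kap] card_of_Well_order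
    by (auto simp: is_comp_def card_order_on_well_order_on)
  then have "|(\<lambda>p. {p}) ` Dom I| <o kap" using card_of_image ordLeq_ordLess_trans by blast
  moreover have "(\<lambda>p. {p}) ` Dom I \<subseteq> members I" using sing by auto
  ultimately have "\<Union> ((\<lambda>p. {p}) ` Dom I) \<in> members I"
    using assms(2) unfolding is_comp_def kappa_complete_def by blast
  then show False using assms(1) by (simp add: is_ideal_def)
qed

lemma card_of_nsets_2:
  assumes "infinite A"
  shows "|nsets A 2| \<le>o |A|"
proof -
  have "nsets A 2 \<subseteq> (\<lambda>(a, b). {a, b}) ` (A \<times> A)" by (auto simp: nsets_2_eq)
  then have "|nsets A 2| \<le>o |A \<times> A|"
    using card_of_mono1 card_of_image ordLeq_transitive by blast
  also have "|A \<times> A| =o |A|" using assms by (rule card_of_Times_same_infinite)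
  finally show ?thesis .
qed

lemma finite_imp_card_of_ordLeq:
  assumes "finite A" "infinite B"
  shows "|A| \<le>o |B|"
proof -
  have "|A| <o natLeq" "natLeq \<le>o |B|"
    using assms finite_iff_ordLess_natLeq infinite_iff_natLeq_ordLeq by blast+
  then show ?thesis using ordLess_ordLeq_trans ordLess_imp_ordLeq by blast
qed

section \<open>Unbounded sets and matchings\<close>

lemma full_card_unbounded:
  assumes lam: "Card_order lam" and X: "X \<subseteq> Field lam" "|X| =o lam"
  shows "unbounded_in lam X"
  unfolding unbounded_in_def
proof (intro conjI ballI X(1))
  fix a assume a: "a \<in> Field lam"
  show "\<exists>b\<in>X. (a, b) \<in> lam"
  proof (rule ccontr)
    assume neg: "\<not> ?thesis"
    have wo: "wo_rel lam" using lam by (simp add: wo_rel_def card_order_on_well_order_on)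
    have "X \<subseteq> underS lam a"
    proof
      fix b assume b: "b \<in> X"
      then have "(a, b) \<notin> lam" "b \<in> Field lam" using neg X(1) by auto
      moreover have "(a, a) \<in> lam" using wo_rel.TOTALS[OF wo] a by blast
      ultimately show "b \<in> underS lam a"
        using wo_rel.TOTALS[OF wo] a by (auto simp: underS_def)
    qed
    then have "|X| <o lam"
      using card_of_underS[OF lam a] card_of_mono1 ordLeq_ordLess_trans by blast
    then show False using X(2) not_ordLess_ordIso by blast
  qed
qed

lemma card_of_Diff_finite:
  assumes lam: "Card_order lam" "infinite (Field lam)" and X: "|X| =o lam" and F: "finite F"
  shows "|X - F| =o lam"
proof -
  have F_small: "|F| <o lam"
    using lam F finite_ordLess_infinite[of "|F|" lam] card_of_well_order_on[of F]
    by (simp add: Field_card_of card_order_on_well_order_on)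
  have "|X - F| \<le>o lam"
    using card_of_mono1[of "X - F" X] X ordLeq_ordIso_trans by blast
  moreover have "\<not> |X - F| <o lam"
  proof
    assume "|X - F| <o lam"
    then have "|(X - F) \<union> F| <o lam"
      using F_small lam card_of_Un_ordLess_infinite_Field by blast
    then have "|X| <o lam"
      using card_of_mono1[of X "(X - F) \<union> F"] ordLeq_ordLess_trans by blast
    then show False using X not_ordLess_ordIso by blast
  qed
  ultimately show ?thesis using ordLeq_iff_ordLess_or_ordIso by blast
qed

text \<open>
  Take a maximal family of disjoint pairs on which \<open>f\<close> is constant.  The points that it leaves out
  have different values under \<open>f\<close>, so there are fewer than \<open>\<lambda>\<close> of them, and the family has size \<open>\<lambda>\<close>.
  Its pairs are ordered by \<open>lam\<close> and indexed by \<open>\<lambda>\<close>, as the super property demands.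
\<close>

lemma full_matching:
  fixes f :: "'l \<Rightarrow> 'b"
  assumes lam: "Card_order lam" "infinite (Field lam)" and small: "|f ` Field lam| <o lam"
  obtains b :: "'l \<Rightarrow> nat \<Rightarrow> 'l" where
    "\<And>a l. a \<in> Field lam \<Longrightarrow> l < 2 \<Longrightarrow> b a l \<in> Field lam"
    "inj_on (\<lambda>(a, l). b a l) (Field lam \<times> {..<2})"
    "\<And>a. a \<in> Field lam \<Longrightarrow> (b a 0, b a 1) \<in> lam \<and> b a 0 \<noteq> b a 1 \<and> f (b a 0) = f (b a 1)"
proof -
  define P where "P = {(x, y). x \<in> Field lam \<and> y \<in> Field lam \<and> x \<noteq> y \<and> (x, y) \<in> lam \<and> f x = f y}"
  define \<M> where "\<M> = {M. M \<subseteq> P \<and>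
    (\<forall>p\<in>M. \<forall>q\<in>M. p \<noteq> q \<longrightarrow> {fst p, snd p} \<inter> {fst q, snd q} = {})}"
  have "\<Union>C \<in> \<M>" if C: "subset.chain \<M> C" for C
  proof -
    have sub: "\<Union>C \<subseteq> P" using C by (fastforce simp: subset_chain_def \<M>_def)
    have "{fst p, snd p} \<inter> {fst q, snd q} = {}"
      if pq: "p \<in> \<Union>C" "q \<in> \<Union>C" "p \<noteq> q" for p q
    proof -
      obtain M where M: "M \<in> C" "p \<in> M" "q \<in> M"
        using pq C unfolding subset_chain_def by blast
      then have "M \<in> \<M>" using C by (auto simp: subset_chain_def)
      then show ?thesis using M pq(3) by (auto simp: \<M>_def)
    qed
    then show ?thesis using sub by (simp add: \<M>_def)
  qed
  then obtain M where M: "M \<in> \<M>" and max: "\<And>X. X \<in> \<M> \<Longrightarrow> M \<subseteq> X \<Longrightarrow> X = M"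
    using subset_Zorn'[of \<M>] by blast
  have dj: "{fst p, snd p} \<inter> {fst q, snd q} = {}" if "p \<in> M" "q \<in> M" "p \<noteq> q" for p q
    using M that by (simp add: \<M>_def)
  have MP: "M \<subseteq> P" using M by (simp add: \<M>_def)
  define S where "S = fst ` M \<union> snd ` M"
  have wo: "wo_rel lam" using lam by (simp add: wo_rel_def card_order_on_well_order_on)
  have "inj_on f (Field lam - S)"
  proof (rule inj_onI, rule ccontr)
    fix x0 y0 assume *: "x0 \<in> Field lam - S" "y0 \<in> Field lam - S" "f x0 = f y0" "x0 \<noteq> y0"
    have "(x0, y0) \<in> lam \<or> (y0, x0) \<in> lam"
      using * wo_rel.TOTALS[OF wo] by blast
    then have "(x0, y0) \<in> P \<or> (y0, x0) \<in> P" using * by (auto simp: P_def)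
    then obtain x y where xy: "(x, y) \<in> P" "x \<notin> S" "y \<notin> S" using *(1,2) by blast
    have new: "{x, y} \<inter> {fst p, snd p} = {}" if "p \<in> M" for p
      using xy(2,3) that by (auto simp: S_def)
    have "{fst p, snd p} \<inter> {fst q, snd q} = {}"
      if pq: "p \<in> insert (x, y) M" "q \<in> insert (x, y) M" "p \<noteq> q" for p q
    proof -
      consider "p = (x, y)" "q \<in> M" | "q = (x, y)" "p \<in> M" | "p \<in> M" "q \<in> M"
        using pq by blast
      then show ?thesis
      proof cases
        case 1
        then show ?thesis using new[of q] by simp
      next
        case 2
        then show ?thesis using new[of p] by auto
      next
        case 3
        then show ?thesis using dj pq(3) by blast
      qed
    qed
    then have "insert (x, y) M \<in> \<M>" using xy(1) MP by (simp add: \<M>_def)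
    then have "(x, y) \<in> M" using max by blast
    then show False using xy(2) by (force simp: S_def)
  qed
  then have "|Field lam - S| \<le>o |f ` Field lam|"
    by (meson card_of_ordLeq image_mono Diff_subset)
  then have rest: "|Field lam - S| <o lam" using small ordLeq_ordLess_trans by blast
  have "lam \<le>o |M|"
  proof (rule ccontr)
    assume "\<not> ?thesis"
    then have "|M| <o lam"
      using lam(1) not_ordLeq_iff_ordLess[of "|M|" lam] card_of_Well_order by (auto simp: card_order_on_well_order_on)
    then have "|S| <o lam" unfolding S_def
      by (intro card_of_Un_ordLess_infinite_Field lam) (meson card_of_image ordLeq_ordLess_trans)+
    then have "|S \<union> (Field lam - S)| <o lam"
      using rest lam card_of_Un_ordLess_infinite_Field by blast
    then have "|Field lam| <o lam" using card_of_mono1 ordLeq_ordLess_trans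
      by (metis Un_Diff_cancel Un_upper2)
    then show False using card_of_Field_ordIso[OF lam(1)] not_ordLess_ordIso by blast
  qed
  then have "|Field lam| \<le>o |M|" 
    by (rule ordIso_ordLeq_trans[OF card_of_Field_ordIso[OF lam(1)]])
  then obtain g where g: "inj_on g (Field lam)" "g ` Field lam \<subseteq> M"
    unfolding card_of_ordLeq[symmetric] by blast
  define b where "b a l = (if l = 0 then fst (g a) else snd (g a))" for a and l :: nat
  have gM: "g a \<in> M" and gP: "g a \<in> P" if "a \<in> Field lam" for a
    using that g(2) MP by blast+
  show thesis
  proof (rule that[of b])
    show "b a l \<in> Field lam" if "a \<in> Field lam" for a l
      using gP[OF that] by (auto simp: b_def P_def)
    show "(b a 0, b a 1) \<in> lam \<and> b a 0 \<noteq> b a 1 \<and> f (b a 0) = f (b a 1)" if "a \<in> Field lam" for a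
      using gP[OF that] by (auto simp: b_def P_def)
    have inj: "a = a' \<and> l = l'"
      if *: "a \<in> Field lam" "a' \<in> Field lam" "l < 2" "l' < 2" "b a l = b a' l'" for a a' l l'
    proof -
      have "g a = g a'"
        using dj[OF gM[OF *(1)] gM[OF *(2)]] *(5) by (auto simp: b_def split: if_splits)
      then have a: "a = a'" using inj_onD[OF g(1)] *(1,2) by blast
      have "fst (g a) \<noteq> snd (g a)" using gP[OF *(1)] by (auto simp: P_def)
      then have "l = 0 \<longleftrightarrow> l' = 0" using *(5) a by (auto simp: b_def split: if_splits)
      then show ?thesis using a *(3,4) by auto
    qed
    show "inj_on (\<lambda>(a, l). b a l) (Field lam \<times> {..<2})"
    proof (rule inj_onI)
      fix x y assume xy: "x \<in> Field lam \<times> {..<2}" "y \<in> Field lam \<times> {..<2}"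
        "(case x of (a, l) \<Rightarrow> b a l) = (case y of (a, l) \<Rightarrow> b a l)"
      obtain a l a' l' where eqs: "x = (a, l)" "y = (a', l')" by (cases x, cases y)
      have "a = a' \<and> l = l'"
        using xy unfolding eqs prod.case mem_Times_iff fst_conv snd_conv lessThan_iff
        by (intro inj) blast+
      then show "x = y" by (simp add: eqs)
    qed
  qed
qed

section \<open>The first monochromatic edge\<close>

text \<open>
  \<open>S\<close> is the set of vertices coloured ``true'', tagged by their levels, and \<open>p k\<close> is the edge at level
  \<open>k\<close>.  If no level in \<open>W\<close> has a monochromatic edge, the value is false.
\<close>

definition first_mono_true :: "'d::wellorder set \<Rightarrow> ('d \<Rightarrow> 'p set) \<Rightarrow> ('d \<times> 'p) set \<Rightarrow> bool" where
  "first_mono_true W p S \<longleftrightarrow>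
     (\<exists>j\<in>W. (\<forall>a\<in>p j. (j, a) \<in> S) \<and>
        (\<forall>k\<in>W. k < j \<longrightarrow> (\<exists>a\<in>p k. (k, a) \<in> S) \<and> (\<exists>a\<in>p k. (k, a) \<notin> S)))"

lemma first_mono_true_cong:
  assumes "\<And>k a. k \<in> W \<Longrightarrow> a \<in> p k \<Longrightarrow> (k, a) \<in> S \<longleftrightarrow> (k, a) \<in> S'"
  shows "first_mono_true W p S \<longleftrightarrow> first_mono_true W p S'"
  unfolding first_mono_true_def using assms by (simp cong: ball_cong bex_cong)

text \<open>
  The edges \<open>ab\<close> and \<open>cd\<close> alone cannot be the edges of value true in a complete graph on
  \<open>a, b, c, d\<close>.  If one of them is decided below \<open>j\<close>, then so are all six, in the same way.
  Otherwise both have an end coloured true at level \<open>j\<close>, and the edge between these two ends is decided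
  there, with value true.
\<close>

lemma first_mono_true_cross_edge:
  assumes j: "j \<in> W \<or> W \<subseteq> {..<j}"
    and below: "\<And>P k. P \<in> nsets u 2 \<Longrightarrow> k < j \<Longrightarrow> p P k = \<rho> k"
    and at: "\<And>P. P \<in> nsets u 2 \<Longrightarrow> p P j = P"
    and u: "{a, b, c, d} \<subseteq> u" "distinct [a, b, c, d]"
    and ab: "first_mono_true W (p {a, b}) S" and cd: "first_mono_true W (p {c, d}) S"
  shows "\<exists>x\<in>{a, b}. \<exists>y\<in>{c, d}. first_mono_true W (p {x, y}) S"
proof -
  have e: "{a, b} \<in> nsets u 2" "{c, d} \<in> nsets u 2" using u by auto
  have cross: "{x, y} \<in> nsets u 2" if "x \<in> {a, b}" "y \<in> {c, d}" for x y
    using u that by auto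
  define mixed where "mixed P k \<longleftrightarrow> (\<exists>a\<in>p P k. (k, a) \<in> S) \<and> (\<exists>a\<in>p P k. (k, a) \<notin> S)" for P k
  have def: "first_mono_true W (p P) S \<longleftrightarrow>
      (\<exists>k\<in>W. (\<forall>a\<in>p P k. (k, a) \<in> S) \<and> (\<forall>l\<in>W. l < k \<longrightarrow> mixed P l))" for P
    by (simp add: first_mono_true_def mixed_def)
  have mixed_eq: "mixed P l = mixed Q l" if "P \<in> nsets u 2" "Q \<in> nsets u 2" "l < j" for P Q l
    using below that by (simp add: mixed_def)
  have early: "first_mono_true W (p Q) S"
    if "P \<in> nsets u 2" "Q \<in> nsets u 2" "k \<in> W" "k < j" "\<forall>a\<in>p P k. (k, a) \<in> S"
      "\<forall>l\<in>W. l < k \<longrightarrow> mixed P l" for P Q k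
    unfolding def using that below mixed_eq[OF that(1,2)]
    by (intro bexI[OF _ that(3)]) auto
  have hit: "j \<in> W \<and> (\<exists>x\<in>P. (j, x) \<in> S)"
    if "P \<in> nsets u 2" "k \<in> W" "\<not> k < j" "\<forall>a\<in>p P k. (k, a) \<in> S"
      "\<forall>l\<in>W. l < k \<longrightarrow> mixed P l" for P k
  proof -
    have jW: "j \<in> W" using j that(2,3) by auto
    have "P \<noteq> {}" using that(1) by (auto simp: nsets_def)
    then show ?thesis
      using that jW at[OF that(1)] by (cases "k = j") (auto simp: mixed_def)
  qed
  obtain k where k: "k \<in> W" "\<forall>x\<in>p {a, b} k. (k, x) \<in> S" "\<forall>l\<in>W. l < k \<longrightarrow> mixed {a, b} l"
    using ab unfolding def by blast
  obtain k' where k': "k' \<in> W" "\<forall>x\<in>p {c, d} k'. (k', x) \<in> S" "\<forall>l\<in>W. l < k' \<longrightarrow> mixed {c, d} l"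
    using cd unfolding def by blast
  show ?thesis
  proof (cases "k < j \<or> k' < j")
    case True
    then have "first_mono_true W (p {a, c}) S"
      using early[OF e(1) cross k(1) _ k(2,3)] early[OF e(2) cross k'(1) _ k'(2,3)] by blast
    then show ?thesis by blast
  next
    case False
    then obtain x y where xy: "x \<in> {a, b}" "(j, x) \<in> S" "y \<in> {c, d}" "(j, y) \<in> S" and jW: "j \<in> W"
      using hit[OF e(1) k(1) _ k(2,3)] hit[OF e(2) k'(1) _ k'(2,3)] by blast
    have "mixed {x, y} l" if "l \<in> W" "l < j" for l
      using k(3) False that mixed_eq[OF e(1) cross[OF xy(1,3)] that(2)] by auto
    then have "first_mono_true W (p {x, y}) S"
      unfolding def using xy at[OF cross[OF xy(1,3)]] by (intro bexI[OF _ jW]) auto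
    then show ?thesis using xy by blast
  qed
qed

text \<open>
  The colouring gives both colours to each common edge below \<open>j\<close>, so that the decision is left to level
  \<open>j\<close>, where exactly the vertices of \<open>p j\<close> are true.  The edge \<open>q j\<close> has the same size and is not
  contained in \<open>p j\<close>.
\<close>

lemma first_mono_true_separates:
  assumes j: "j \<in> W" "W \<subseteq> {..j}" and ne: "p j \<noteq> q j"
    and below: "\<And>k. k \<in> W \<Longrightarrow> k < j \<Longrightarrow> p k = q k"
    and two: "\<And>k. k \<in> W \<Longrightarrow> card (p k) = 2 \<and> card (q k) = 2"
  obtains S where "S \<subseteq> (SIGMA k:W. p k)" "first_mono_true W p S" "\<not> first_mono_true W q S"
proof -
  define c where "c k = (SOME a. a \<in> p k)" for k
  have c: "c k \<in> p k" if "k \<in> W" for k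
    using two[OF that] unfolding c_def by (metis card.empty ex_in_conv someI_ex zero_neq_numeral)
  have c': "\<exists>a\<in>p k. a \<noteq> c k" if "k \<in> W" for k
    using two[OF that] by (auto simp: card_2_iff) 
  define S where "S = (SIGMA k:W. if k = j then p k else {c k})"
  have "S \<subseteq> (SIGMA k:W. p k)" using c by (auto simp: S_def split: if_splits)
  moreover have "first_mono_true W p S"
    unfolding first_mono_true_def
  proof (intro bexI[of _ j] conjI ballI impI)
    show "\<exists>a\<in>p k. (k, a) \<in> S" "\<exists>a\<in>p k. (k, a) \<notin> S" if "k \<in> W" "k < j" for k
      using that c[of k] c'[of k] by (auto simp: S_def)
  qed (use j in \<open>auto simp: S_def\<close>)
  moreover have "\<not> first_mono_true W q S"
  proof
    assume "first_mono_true W q S"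
    then obtain k where k: "k \<in> W" "\<forall>a\<in>q k. (k, a) \<in> S" by (auto simp: first_mono_true_def)
    show False
    proof (cases "k = j")
      case True
      then have "q j \<subseteq> p j" using k by (auto simp: S_def)
      moreover have "finite (p j)" using two[OF j(1)] by (auto intro: card_ge_0_finite)
      ultimately show False using ne two[OF j(1)] by (metis card_subset_eq)
    next
      case False
      then have "k < j" using k(1) j(2) by auto
      then show False using c'[OF k(1)] k below[OF k(1)] False by (auto simp: S_def)
    qed
  qed
  ultimately show thesis by (rule that)
qed

section \<open>Splitting patterns\<close>

text \<open>
  Sorting the \<open>\<alpha> \<in> X\<close> by \<open>\<eta>\<^sub>\<alpha> \<restriction> j\<close> gives fewer pieces than the completeness of \<open>I\<^sub>j\<close>, so the pieces cannot
  all be small.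
\<close>

lemma positive_piece:
  fixes eta :: "'l \<Rightarrow> 'd::wellorder \<Rightarrow> 'a"
  assumes normal: "normal_sequence lam I eta" and X: "X \<subseteq> Field lam"
    and pos: "{eta a j | a. a \<in> X} \<notin> members (I j)"
  obtains \<rho> where "{eta a j | a. a \<in> X \<and> restrict (eta a) {..<j} = \<rho>} \<notin> members (I j)"
proof (rule ccontr)
  assume "\<not> thesis"
  then have all: "{eta a j | a. a \<in> X \<and> restrict (eta a) {..<j} = \<rho>} \<in> members (I j)" for \<rho>
    using that by blast
  let ?R = "{restrict (eta a) {..<j} | a. a \<in> Field lam}"
  let ?F = "(\<lambda>\<rho>. {eta a j | a. a \<in> X \<and> restrict (eta a) {..<j} = \<rho>}) ` ?R"
  obtain kap where kap: "is_comp (I j) kap" "|?R| <o kap"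
    using normal unfolding normal_sequence_def by blast
  have "|?F| <o kap" using kap(2) card_of_image ordLeq_ordLess_trans by blast
  moreover have "?F \<subseteq> members (I j)" using all by auto
  ultimately have "\<Union>?F \<in> members (I j)"
    using kap(1) unfolding is_comp_def kappa_complete_def by blast
  moreover have "\<Union>?F = {eta a j | a. a \<in> X}" using X by auto
  ultimately show False using pos by simp
qed

text \<open>
  A pattern that no coordinate can satisfy, as long as its levels either include \<open>j\<close> or all precede
  \<open>j\<close>.  The sets \<open>W\<close> and the colourings \<open>S\<close> are arbitrary, so that one pair \<open>u, v\<close> serves infinitely
  many coordinates at once.
\<close>

definition splits_at :: "('l \<Rightarrow> 'd::wellorder \<Rightarrow> 'p set) \<Rightarrow> 'l set \<Rightarrow> 'l set \<Rightarrow> 'd \<Rightarrow> bool" where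
  "splits_at eta u v j \<longleftrightarrow>
     (\<forall>W S. j \<in> W \<or> W \<subseteq> {..<j} \<longrightarrow>
        \<not> ((\<forall>a\<in>u. first_mono_true W (eta a) S) \<and> (\<forall>a\<in>v. \<not> first_mono_true W (eta a) S)))"

lemma ex_splitting_pattern:
  fixes eta :: "'l \<Rightarrow> 'd::wellorder \<Rightarrow> 'p set"
  assumes normal: "normal_sequence lam I eta" and X: "X \<subseteq> Field lam"
    and I: "I j = ERI2 L K" and K: "|{()}| <o K" "Card_order K"
    and eta: "\<And>a. a \<in> Field lam \<Longrightarrow> eta a j \<in> nsets (Field L) 2"
    and pos: "{eta a j | a. a \<in> X} \<notin> members (I j)"
  obtains u v where "finite u" "finite v" "u \<subseteq> X" "v \<subseteq> X" "u \<inter> v = {}" "splits_at eta u v j"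
proof -
  obtain \<rho> where \<rho>: "{eta a j | a. a \<in> X \<and> restrict (eta a) {..<j} = \<rho>} \<notin> members (I j)"
    using positive_piece[where eta = eta, OF normal X pos] by blast
  obtain w where w: "infinite w" "nsets w 2 \<subseteq> {eta a j | a. a \<in> X \<and> restrict (eta a) {..<j} = \<rho>}"
    by (rule ERI2_large_contains_complete[OF K, of "{eta a j | a. a \<in> X \<and> restrict (eta a) {..<j} = \<rho>}" L])
      (use eta X \<rho> I in auto)
  \<comment> \<open>An index that realises the edge \<open>P\<close> at \<open>j\<close> and has the chosen past.\<close>
  define g where "g P = (SOME a. a \<in> X \<and> restrict (eta a) {..<j} = \<rho> \<and> eta a j = P)" for P
  have g: "g P \<in> X \<and> restrict (eta (g P)) {..<j} = \<rho> \<and> eta (g P) j = P" if "P \<in> nsets w 2" for P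
    unfolding g_def by (rule someI_ex) (use w(2) that in blast)
  have below: "eta (g P) k = \<rho> k" if "P \<in> nsets w 2" "k < j" for P k
    using g[OF that(1)] that(2) by (metis lessThan_iff restrict_apply)
  obtain T where T: "T \<subseteq> w" "finite T" "card T = 4"
    using infinite_arbitrarily_large[OF w(1)] by blast
  then obtain l where l: "set l = T" "distinct l" "length l = 4"
    using finite_distinct_list distinct_card by metis
  then obtain a b c d where abcd: "l = [a, b, c, d]"
    by (auto simp: length_Suc_conv eval_nat_numeral)
  have dist: "distinct [a, b, c, d]" and sub: "{a, b, c, d} \<subseteq> w" using l T(1) abcd by auto
  let ?u = "{g {a, b}, g {c, d}}"
  let ?v = "(\<lambda>(x, y). g {x, y}) ` ({a, b} \<times> {c, d})"
  have inj: "P = Q" if "P \<in> nsets w 2" "Q \<in> nsets w 2" "g P = g Q" for P Q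
    using g that by metis
  show thesis
  proof (rule that[of ?u ?v])
    show "?u \<subseteq> X" "?v \<subseteq> X" using g dist sub by auto
    show "?u \<inter> ?v = {}"
      using dist sub by (auto dest!: inj[rotated 2] simp: doubleton_eq_iff)
    show "splits_at eta ?u ?v j"
      unfolding splits_at_def
    proof (intro allI impI notI, elim conjE)
      fix W S assume j: "j \<in> W \<or> W \<subseteq> {..<j}"
        and u: "\<forall>a\<in>?u. first_mono_true W (eta a) S" and v: "\<forall>a\<in>?v. \<not> first_mono_true W (eta a) S"
      have "\<exists>x\<in>{a, b}. \<exists>y\<in>{c, d}. first_mono_true W (eta (g {x, y})) S"
        by (rule first_mono_true_cross_edge[of j W w "\<lambda>P. eta (g P)" \<rho>])
          (use j below g dist sub u in auto)
      then show False using v by auto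
    qed
  qed auto
qed

section \<open>Realisation in the product\<close>

lemma FBA_on_empty: "{} \<in> FBA_on S"
  using FBA_on.compl[OF FBA_on.top] by simp

lemma FBA_on_Un: "A \<in> FBA_on S \<Longrightarrow> B \<in> FBA_on S \<Longrightarrow> A \<union> B \<in> FBA_on S"
  using is_subalgebra_FBA_on[of S] by (auto simp: is_subalgebra_def)

lemma FBA_on_UN: "finite F \<Longrightarrow> (\<And>x. x \<in> F \<Longrightarrow> A x \<in> FBA_on S) \<Longrightarrow> (\<Union>x\<in>F. A x) \<in> FBA_on S"
  by (induction F rule: finite_induct) (auto intro: FBA_on_empty FBA_on_Un)

lemma FBA_on_INT: "finite F \<Longrightarrow> (\<And>x. x \<in> F \<Longrightarrow> A x \<in> FBA_on S) \<Longrightarrow> (\<Inter>x\<in>F. A x) \<in> FBA_on S"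
  by (induction F rule: finite_induct) (auto intro: FBA_on.top FBA_on.inter)

lemma first_mono_true_in_FBA:
  assumes W: "finite W" and p: "\<And>k. k \<in> W \<Longrightarrow> finite (p k)"
    and e: "\<And>k a. k \<in> W \<Longrightarrow> a \<in> p k \<Longrightarrow> e (k, a) \<in> S"
  shows "{V. first_mono_true W p (e -` V)} \<in> FBA_on S"
proof -
  let ?G = "\<lambda>k a. FBA_gen (e (k, a))"
  let ?B = "\<lambda>j k. if k < j then (\<Union>a\<in>p k. ?G k a) \<inter> (\<Union>a\<in>p k. - ?G k a) else UNIV"
  have "{V. first_mono_true W p (e -` V)} = (\<Union>j\<in>W. (\<Inter>a\<in>p j. ?G j a) \<inter> (\<Inter>k\<in>W. ?B j k))"
    by (auto simp: first_mono_true_def FBA_gen_def simp del: if_image_distrib split: if_splits)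
  also have "\<dots> \<in> FBA_on S"
    by (intro FBA_on_UN FBA_on.inter FBA_on_INT W p)
      (auto intro!: FBA_on.inter FBA_on_UN FBA_on.compl FBA_on.gen FBA_on.top W p e)
  finally show ?thesis .
qed

text \<open>
  At level \<open>i\<close> the vertices lie in \<open>\<lambda>\<^sub>i\<close> anyway.  At a level \<open>k < i\<close> the edge \<open>\<eta>\<^sub>\<alpha>(k)\<close> is read off from
  \<open>\<eta>\<^sub>\<alpha> \<restriction> i\<close>, which by normality takes fewer than \<open>comp(I\<^sub>i) \<le> \<lambda>\<^sub>i\<close> values, although \<open>\<lambda>\<^sub>k\<close> itself may
  be larger than \<open>\<lambda>\<^sub>i\<close>.  There are countably many levels and \<open>\<lambda>\<^sub>i\<close> is infinite, so all of this fits.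
\<close>

lemma ex_coding:
  fixes eta :: "'l \<Rightarrow> 'd::wellorder \<Rightarrow> 'p set"
  assumes "countable (UNIV :: 'd set)" and normal: "normal_sequence lam I eta"
    and ideal: "is_ideal (I i)" and I: "I i = ERI2 L K" and K: "|{()}| <o K" "Card_order K"
    and eta: "\<And>a. a \<in> Field lam \<Longrightarrow> eta a i \<subseteq> Field L"
    and fin: "\<And>a k. a \<in> Field lam \<Longrightarrow> finite (eta a k)"
  obtains e where "inj_on e (SIGMA k:{..i}. \<Union>a\<in>Field lam. eta a k)"
    "e ` (SIGMA k:{..i}. \<Union>a\<in>Field lam. eta a k) \<subseteq> Field L"
proof -
  have "Dom (I i) \<notin> members (ERI2 L K)" using ideal I by (simp add: is_ideal_def)
  moreover have Dom: "Dom (I i) = nsets (Field L) 2" by (simp add: I ERI2_def Dom_def)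
  ultimately obtain u where "infinite u" "u \<subseteq> Field L"
    using ERI2_large_contains_complete[OF K, of "Dom (I i)" L] by blast
  then have inf: "infinite (Field L)" using finite_subset by blast
  obtain kap where kap: "is_comp (I i) kap" "|{restrict (eta a) {..<i} | a. a \<in> Field lam}| <o kap"
    using normal unfolding normal_sequence_def by blast
  have "kap \<le>o |Dom (I i)|"
    by (rule comp_ordLeq_Dom[OF ideal kap(1)]) (use ERI2_singleton[OF K] Dom I in auto)
  also have "|Dom (I i)| \<le>o |Field L|" unfolding Dom by (rule card_of_nsets_2[OF inf])
  finally have R: "|{restrict (eta a) {..<i} | a. a \<in> Field lam}| \<le>o |Field L|"
    using kap(2) ordLess_ordLeq_trans ordLess_imp_ordLeq by blast
  have U: "|\<Union>a\<in>Field lam. eta a k| \<le>o |Field L|" if "k \<le> i" for k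
  proof (cases "k = i")
    case True
    then show ?thesis using eta by (auto intro!: card_of_mono1)
  next
    case False
    then have "k < i" using that by simp
    let ?R = "{restrict (eta a) {..<i} | a. a \<in> Field lam}"
    have eq: "(\<Union>a\<in>Field lam. eta a k) = (\<Union>r\<in>?R. r k)" using \<open>k < i\<close> by auto
    have "|r k| \<le>o |Field L|" if "r \<in> ?R" for r
    proof -
      have "finite (r k)" using that \<open>k < i\<close> fin by auto
      then show ?thesis using inf finite_imp_card_of_ordLeq by blast
    qed
    then show ?thesis unfolding eq by (intro card_of_UNION_ordLeq_infinite inf R) auto
  qed
  have "|{..i}| \<le>o |Field L|"
  proof -
    have "|{..i}| \<le>o |UNIV :: nat set|"
      using assms(1) countable_subset[of "{..i}" UNIV] by (auto simp: countable_def card_of_ordLeq[symmetric])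
    then show ?thesis using inf infinite_iff_card_of_nat ordLeq_transitive by blast
  qed
  then have "|SIGMA k:{..i}. \<Union>a\<in>Field lam. eta a k| \<le>o |Field L|"
    using U by (intro card_of_Sigma_ordLeq_infinite inf) auto
  then show thesis using that unfolding card_of_ordLeq[symmetric] by blast
qed

lemma countable_of_ordLess_cardSuc:
  assumes "{(i :: 'd::wellorder, j). i \<le> j} <o cardSuc natLeq"
  shows "countable (UNIV :: 'd set)"
proof -
  have "|Field {(i :: 'd, j). i \<le> j}| <o cardSuc natLeq" using assms by (rule ordLess_Field)
  moreover have "Field {(i :: 'd, j). i \<le> j} = UNIV" by (auto simp: Field_def)
  ultimately have "|UNIV :: 'd set| \<le>o natLeq"
    by (simp add: cardSuc_ordLeq_ordLess natLeq_Card_order card_of_Card_order)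
  then have "|UNIV :: 'd set| \<le>o |UNIV :: nat set|"
    using ordLeq_ordIso_trans[OF _ ordIso_symmetric[OF card_of_nat]] by blast
  then show ?thesis by (auto simp: countable_def card_of_ordLeq[symmetric])
qed

lemma not_BA_independentI:
  assumes uv: "finite u" "finite v" "u \<subseteq> Y" "v \<subseteq> Y" "u \<inter> v = {}"
    and none: "\<And>i V. \<lbrakk>\<And>y. y \<in> u \<Longrightarrow> V \<in> y i; \<And>y. y \<in> v \<Longrightarrow> V \<notin> y i\<rbrakk> \<Longrightarrow> False"
  shows "\<not> BA_independent (Y :: ('d \<Rightarrow> 'b set) set)"
proof -
  let ?Z = "Inf_fin (insert top (u \<union> uminus ` v))"
  have le: "?Z \<le> y" if "y \<in> u \<union> uminus ` v" for y
    using uv that by (intro Inf_fin.coboundedI) auto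
  have "?Z i = {}" for i
  proof (rule ccontr)
    assume "?Z i \<noteq> {}"
    then obtain V where V: "V \<in> ?Z i" by blast
    have "V \<in> y i" if "y \<in> u" for y using le[of y] that V by (auto simp: le_fun_def)
    moreover have "V \<notin> y i" if "y \<in> v" for y using le[of "- y"] that V by (auto simp: le_fun_def)
    ultimately show False using none by blast
  qed
  then have "?Z = bot" by (simp add: fun_eq_iff)
  then show ?thesis using uv unfolding BA_independent_def by blast
qed

text \<open>
  On \<open>D\<close> the pairs \<open>\<langle>\<eta>(i), \<eta>(i)\<rangle>\<close> of equal entries lie on the diagonal, all of whose sections are at most
  singletons, hence small.  So the diagonal belongs to \<open>I\<^sub>i \<times> I\<^sub>i\<close> for all \<open>i \<in> D\<close>, while the super
  property admits this only on a set in \<open>J\<close>.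
\<close>

lemma super_sequence_no_repetition:
  assumes super: "super_sequence lam J I eta" and ideal: "\<And>i. is_ideal (I i)"
    and Dom: "\<And>a i. a \<in> Field lam \<Longrightarrow> eta a i \<in> Dom (I i)"
    and sing: "\<And>i p. p \<in> Dom (I i) \<Longrightarrow> {p} \<in> members (I i)"
    and J: "\<And>A B. A \<in> members J \<Longrightarrow> B \<subseteq> A \<Longrightarrow> B \<in> members J"
    and D: "D \<notin> members J"
    and b: "\<And>a l. a \<in> Field lam \<Longrightarrow> l < 2 \<Longrightarrow> b a l \<in> Field lam"
      "inj_on (\<lambda>(a, l). b a l) (Field lam \<times> {..<2::nat})"
      "\<And>a. a \<in> Field lam \<Longrightarrow> (b a 0, b a 1) \<in> lam \<and> b a 0 \<noteq> b a 1"
    and same: "\<And>a i. a \<in> Field lam \<Longrightarrow> i \<in> D \<Longrightarrow> eta (b a 0) i = eta (b a 1) i"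
  shows False
proof -
  have b2: "\<forall>a\<in>Field lam. \<forall>l l'. l < l' \<and> l' < 2 \<longrightarrow> (b a l, b a l') \<in> lam \<and> b a l \<noteq> b a l'"
  proof (intro ballI allI impI)
    fix a and l l' :: nat assume "a \<in> Field lam" "l < l' \<and> l' < 2"
    moreover from this have "l = 0" "l' = 1" by auto
    ultimately show "(b a l, b a l') \<in> lam \<and> b a l \<noteq> b a l'" using b(3) by simp
  qed
  have "{i. {map (\<lambda>l. eta (b a l) i) [0..<2] | a. a \<in> Field lam}
      \<in> members (prod_ideal (replicate 2 (I i)))} \<in> members J"
    by (rule super[unfolded super_sequence_def, rule_format, THEN conjunct1]) (use b b2 in auto)
  moreover have "D \<subseteq> {i. {map (\<lambda>l. eta (b a l) i) [0..<2] | a. a \<in> Field lam}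
      \<in> members (prod_ideal (replicate 2 (I i)))}"
  proof
    fix i assume i: "i \<in> D"
    define X where "X = {map (\<lambda>l. eta (b a l) i) [0..<2] | a. a \<in> Field lam}"
    have X: "X = {[eta (b a 0) i, eta (b a 0) i] | a. a \<in> Field lam}"
      using same[OF _ i] by (auto simp: X_def upt_rec[of 0] upt_rec[of 1] numeral_2_eq_2)
    have "X \<subseteq> listset (map Dom (replicate 2 (I i)))"
      unfolding X using b(1) Dom by (auto simp: numeral_2_eq_2 set_Cons_def)
    moreover have "\<not> ex_pos (replicate 2 (I i)) X"
    proof -
      have "{y \<in> Dom (I i). [x, y] \<in> X} \<notin> positive (I i)" if "x \<in> Dom (I i)" for x
      proof -
        have "{y \<in> Dom (I i). [x, y] \<in> X} \<subseteq> {x}" unfolding X by auto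
        then show ?thesis
          using sing[OF that] ideal[of i] unfolding is_ideal_def positive_def by blast
      qed
      then have "{x \<in> Dom (I i). {y \<in> Dom (I i). [x, y] \<in> X} \<in> positive (I i)} = {}" by auto
      moreover have "{} \<notin> positive (I i)" using ideal[of i] by (simp add: positive_def is_ideal_def)
      moreover have "ex_pos (replicate 2 (I i)) X \<longleftrightarrow>
          {x \<in> Dom (I i). {y \<in> Dom (I i). [x, y] \<in> X} \<in> positive (I i)} \<in> positive (I i)"
        by (simp add: numeral_2_eq_2)
      ultimately show ?thesis by metis
    qed
    ultimately have "X \<in> members (prod_ideal (replicate 2 (I i)))"
      by (simp add: prod_ideal_def members_def)
    then show "i \<in> {i. {map (\<lambda>l. eta (b a l) i) [0..<2] | a. a \<in> Field lam}
        \<in> members (prod_ideal (replicate 2 (I i)))}"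
      unfolding X_def by (rule CollectI)
  qed
  ultimately show False using J D by blast
qed

theorem mainTheorem6:
  fixes lam :: "'l rel"
    and J :: "'d::wellorder idl"
    and I :: "'d \<Rightarrow> 'p set idl"
    and eta :: "'l \<Rightarrow> 'd \<Rightarrow> 'p set"
    and lams :: "'d \<Rightarrow> 'p rel"
    and kaps :: "'d \<Rightarrow> 'k rel"
  assumes "Card_order lam"
    and "\<And>i. Card_order (lams i)"
    and "\<And>i. Card_order (kaps i)"
    and "J_sequence lam J I eta"
    and "normal_sequence lam I eta"
    and "super_sequence lam J I eta"
    and "\<And>i. I i = ERI2 (lams i) (kaps i)"
    and "{(i :: 'd, j). i \<le> j} <o cardSuc natLeq"
  shows "\<not> free_caliber lam (BA_prod (\<lambda>i. FBA (lams i)))"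
proof -
  note lam = assms(1) and Kc = assms(3) and normal = assms(5) and I = assms(7)
  have J: "is_ideal J" "Dom J = UNIV" and ideal: "\<And>i. is_ideal (I i)"
    and etaD: "\<And>a i. a \<in> Field lam \<Longrightarrow> eta a i \<in> Dom (I i)"
    and Jseq: "\<And>X. unbounded_in lam X \<Longrightarrow> {i. {eta a i | a. a \<in> X} \<in> members (I i)} \<in> members J"
    using assms(4) unfolding J_sequence_def by auto
  have J_sub: "\<And>A B. A \<in> members J \<Longrightarrow> B \<subseteq> A \<Longrightarrow> B \<in> members J"
    and J_Un: "\<And>A B. A \<in> members J \<Longrightarrow> B \<in> members J \<Longrightarrow> A \<union> B \<in> members J"
    and J_UNIV: "UNIV \<notin> members J" and J_empty: "{} \<in> members J"
    using J unfolding is_ideal_def by auto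
  have Dom: "Dom (I i) = nsets (Field (lams i)) 2" for i by (simp add: I ERI2_def Dom_def)
  have eta: "eta a i \<in> nsets (Field (lams i)) 2" if "a \<in> Field lam" for a i
    using etaD[OF that] Dom by auto
  have eta_card: "card (eta a i) = 2" "finite (eta a i)" if "a \<in> Field lam" for a i
    using eta[OF that] by (auto simp: nsets_def)
  have K: "|{()}| <o kaps i" for i
    using normal ERI2_coloring_nontrivial[OF Kc] ideal[of i] unfolding normal_sequence_def I by blast
  have sing: "{p} \<in> members (I i)" if "p \<in> Dom (I i)" for i p
    using ERI2_singleton[OF K Kc] that unfolding Dom unfolding I by blast

  have count: "countable (UNIV :: 'd set)" using assms(8) by (rule countable_of_ordLess_cardSuc)
  then obtain code :: "'d \<Rightarrow> nat" where code: "inj code" unfolding countable_def by blast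
  define D where "D = {i. {..<i} \<in> members J}"
  define W where "W i = (if i \<in> D then {k. k \<le> i \<and> code k \<le> code i} else {})" for i
  \<comment> \<open>Either \<open>D\<close> is everything, or \<open>D\<close> is the initial segment below the least \<open>s\<close> outside \<open>D\<close>.\<close>
  have D: "D \<notin> members J"
  proof (cases "D = UNIV")
    case True
    then show ?thesis using J_UNIV by simp
  next
    case False
    define s where "s = (LEAST i. i \<notin> D)"
    have s: "s \<notin> D" unfolding s_def by (rule LeastI_ex) (use False in auto)
    have "{..<s} \<subseteq> D" using not_less_Least unfolding s_def by blast
    then show ?thesis using s J_sub unfolding D_def by blast
  qed
  have D_down: "k \<in> D" if "i \<in> D" "k \<le> i" for i k
    using that J_sub[of "{..<i}" "{..<k}"] by (auto simp: D_def)
  have W_fin: "finite (W i)" for i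
  proof -
    have "finite (code -` {..code i})" using code by (intro finite_vimageI) auto
    then show ?thesis by (rule finite_subset[rotated]) (auto simp: W_def)
  qed
  have W_le: "W i \<subseteq> {..i}" for i by (auto simp: W_def)

  have "\<exists>e. inj_on e (SIGMA k:{..i}. \<Union>a\<in>Field lam. eta a k) \<and>
      e ` (SIGMA k:{..i}. \<Union>a\<in>Field lam. eta a k) \<subseteq> Field (lams i)" for i
    by (rule ex_coding[OF count normal ideal I K Kc, of i])
      (use eta eta_card in \<open>auto simp: nsets_def\<close>)
  then obtain e where e_inj: "\<And>i. inj_on (e i) (SIGMA k:{..i}. \<Union>a\<in>Field lam. eta a k)"
    and e_ran: "\<And>i. e i ` (SIGMA k:{..i}. \<Union>a\<in>Field lam. eta a k) \<subseteq> Field (lams i)" by metis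
  define f where "f a i = {V. first_mono_true (W i) (eta a) (e i -` V)}" for a i
  have f_prod: "f ` Field lam \<subseteq> BA_prod (\<lambda>i. FBA (lams i))"
  proof -
    have "f a i \<in> FBA (lams i)" if "a \<in> Field lam" for a i
      unfolding f_def FBA_def
    proof (rule first_mono_true_in_FBA[OF W_fin])
      show "e i (k, x) \<in> Field (lams i)" if "k \<in> W i" "x \<in> eta a k" for k x
        using e_ran[of i] that W_le[of i] \<open>a \<in> Field lam\<close> by blast
    qed (use eta_card that in auto)
    then show ?thesis by (auto simp: BA_prod_def)
  qed

  have f_sep: "eta a i = eta b i"
    if ab: "a \<in> Field lam" "b \<in> Field lam" "f a = f b" "i \<in> D" for a b i
  proof (rule ccontr)
    assume "eta a i \<noteq> eta b i"
    \<comment> \<open>The coordinate \<open>j\<close> sees its own level as the last one in \<open>W j\<close>.\<close>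
    define j where "j = (LEAST i. eta a i \<noteq> eta b i)"
    have ne: "eta a j \<noteq> eta b j" unfolding j_def by (rule LeastI) fact
    have "j \<le> i" unfolding j_def by (rule Least_le) fact
    then have jD: "j \<in> D" using D_down ab(4) by blast
    obtain S where S: "S \<subseteq> (SIGMA k:W j. eta a k)" "first_mono_true (W j) (eta a) S"
        "\<not> first_mono_true (W j) (eta b) S"
    proof (rule first_mono_true_separates[of j "W j" "eta a" "eta b"])
      show "eta a k = eta b k" if "k < j" for k using not_less_Least that unfolding j_def by blast
    qed (use jD W_le ne eta_card ab in \<open>auto simp: W_def\<close>)
    let ?T = "SIGMA k:{..j}. \<Union>a\<in>Field lam. eta a k"
    have ST: "S \<subseteq> ?T" using S(1) W_le[of j] ab(1) by blast
    have pre: "x \<in> e j -` (e j ` S) \<longleftrightarrow> x \<in> S" if "x \<in> ?T" for x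
      using inj_on_image_mem_iff[OF e_inj[of j] that ST] unfolding vimage_eq .
    have pre_S: "first_mono_true (W j) (eta c) (e j -` (e j ` S)) \<longleftrightarrow> first_mono_true (W j) (eta c) S"
      if c: "c \<in> Field lam" for c
    proof (rule first_mono_true_cong)
      show "(k, x) \<in> e j -` (e j ` S) \<longleftrightarrow> (k, x) \<in> S" if "k \<in> W j" "x \<in> eta c k" for k x
      proof (rule pre)
        show "(k, x) \<in> ?T" using that c W_le[of j] by blast
      qed
    qed
    have "e j ` S \<in> f a j" "e j ` S \<notin> f b j"
      unfolding f_def mem_Collect_eq pre_S[OF ab(1)] pre_S[OF ab(2)] by (fact S)+
    then show False using ab(3) by simp
  qed

  have meets: "\<exists>j\<in>D. m \<le> j \<and> {eta a j | a. a \<in> X} \<notin> members (I j)"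
    if X: "unbounded_in lam X" and m: "m \<in> D" for X m
  proof (rule ccontr)
    assume "\<not> ?thesis"
    then have "D \<subseteq> {..<m} \<union> {i. {eta a i | a. a \<in> X} \<in> members (I i)}" by force
    moreover have "{..<m} \<in> members J" using m by (simp add: D_def)
    ultimately show False using D J_sub J_Un Jseq[OF X] by blast
  qed
  obtain d where d: "d \<in> D" using D J_empty by fastforce

  \<comment> \<open>Some \<open>j\<close> has infinitely many edges \<open>\<eta>\<^sub>\<alpha>(j)\<close>, because positive sets contain infinite complete graphs.\<close>
  have inf: "infinite (Field lam)"
  proof
    assume fin: "finite (Field lam)"
    have "unbounded_in lam (Field lam)"
      using full_card_unbounded[OF lam] card_of_Field_ordIso[OF lam] by blast
    then obtain j where "{eta a j | a. a \<in> Field lam} \<notin> members (I j)"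
      using meets d by blast
    then obtain u where u: "infinite u" "nsets u 2 \<subseteq> {eta a j | a. a \<in> Field lam}"
      using ERI2_large_contains_complete[OF K Kc, of "{eta a j | a. a \<in> Field lam}" "lams j" j] eta I
      by (smt (verit, del_insts) mem_Collect_eq subsetI)
    then show False using fin infinite_nsets_2 finite_subset by fastforce
  qed

  have f_card: "|f ` Field lam| =o lam"
  proof (rule ccontr)
    have "|f ` Field lam| \<le>o lam"
      using card_of_image card_of_Field_ordIso[OF lam] ordLeq_ordIso_trans by blast
    moreover assume "\<not> ?thesis"
    ultimately have "|f ` Field lam| <o lam" using ordLeq_iff_ordLess_or_ordIso by blast
    then obtain b :: "'l \<Rightarrow> nat \<Rightarrow> 'l" where b:
      "\<And>a l. a \<in> Field lam \<Longrightarrow> l < 2 \<Longrightarrow> b a l \<in> Field lam"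
      "inj_on (\<lambda>(a, l). b a l) (Field lam \<times> {..<2})"
      "\<And>a. a \<in> Field lam \<Longrightarrow> (b a 0, b a 1) \<in> lam \<and> b a 0 \<noteq> b a 1 \<and> f (b a 0) = f (b a 1)"
      using full_matching[OF lam inf] by metis
    show False
      by (rule super_sequence_no_repetition[OF assms(6) ideal etaD sing J_sub D b(1,2)])
        (use b f_sep in auto)
  qed

  have dep: "\<not> BA_independent Y" if Y: "Y \<subseteq> f ` Field lam" "|Y| =o lam" for Y
  proof -
    obtain X where X: "X \<subseteq> Field lam" "inj_on f X" "f ` X = Y"
      using Y(1) unfolding subset_image_inj by blast
    then have "|X| =o |Y|" by (intro card_of_ordIsoI[of f]) (simp add: bij_betw_def)
    then have X_card: "|X| =o lam" using Y(2) ordIso_transitive by blast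
    have pat: "\<exists>j u v. j \<in> D \<and> m \<le> j \<and> finite u \<and> finite v \<and> u \<subseteq> X' \<and> v \<subseteq> X' \<and> u \<inter> v = {} \<and>
        splits_at eta u v j"
      if X': "X' \<subseteq> Field lam" "|X'| =o lam" and m: "m \<in> D" for X' m
    proof -
      have "unbounded_in lam X'" using lam X' by (rule full_card_unbounded)
      from meets[OF this m]
      obtain j where j: "j \<in> D" "m \<le> j" and pos: "{eta a j | a. a \<in> X'} \<notin> members (I j)"
        by blast
      obtain u v where "finite u" "finite v" "u \<subseteq> X'" "v \<subseteq> X'" "u \<inter> v = {}" "splits_at eta u v j"
        by (rule ex_splitting_pattern[OF normal X'(1) I[of j] K[of j] Kc[of j] _ pos])
          (use eta in blast)+
      then show ?thesis using j(1,2) by blast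
    qed
    obtain j0 u0 v0 where 0: "j0 \<in> D" "finite u0" "finite v0" "u0 \<subseteq> X" "v0 \<subseteq> X" "u0 \<inter> v0 = {}"
        "splits_at eta u0 v0 j0"
      using pat[OF X(1) X_card d] by blast
    \<comment> \<open>The coordinates that the first pattern does not reach.\<close>
    define bad where "bad = {i \<in> D. j0 < i \<and> code i < code j0}"
    have "finite (code -` {..code j0})" using code by (intro finite_vimageI) auto
    then have bad_fin: "finite bad" by (rule finite_subset[rotated]) (auto simp: bad_def)
    \<comment> \<open>Inserting \<open>j0\<close> provides for the case that \<open>bad\<close> is empty; \<open>j1 = m\<close> is allowed, since \<open>m \<in> W m\<close>.\<close>
    define m where "m = Max (insert j0 bad)"
    have "m \<in> insert j0 bad" unfolding m_def using bad_fin by (intro Max_in) auto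
    then have m: "m \<in> D" using 0(1) by (auto simp: bad_def)
    have bad_le: "i \<le> m" if "i \<in> bad" for i unfolding m_def using bad_fin that by simp
    have "|X - (u0 \<union> v0)| =o lam" using card_of_Diff_finite[OF lam inf X_card] 0 by blast
    then obtain j1 u1 v1 where 1: "j1 \<in> D" "m \<le> j1" "finite u1" "finite v1"
        "u1 \<subseteq> X - (u0 \<union> v0)" "v1 \<subseteq> X - (u0 \<union> v0)" "u1 \<inter> v1 = {}" "splits_at eta u1 v1 j1"
      using pat[of "X - (u0 \<union> v0)" m] m X(1) by blast
    have split: "j0 \<in> W i \<or> W i \<subseteq> {..<j0} \<or> j1 \<in> W i \<or> W i \<subseteq> {..<j1}" for i
    proof (cases "i \<in> D \<and> j0 \<le> i \<and> j0 \<notin> W i")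
      case True
      then have "i \<in> bad" using 0(1) by (auto simp: bad_def W_def order.order_iff_strict)
      then have "i \<le> j1" using bad_le 1(2) order_trans by blast
      then show ?thesis using 1(1) W_le[of i] by (cases "i = j1") (auto simp: W_def)
    next
      case False
      then show ?thesis using W_le[of i] by (auto simp: W_def)
    qed
    show ?thesis
    proof (rule not_BA_independentI[of "f ` (u0 \<union> u1)" "f ` (v0 \<union> v1)"])
      show "f ` (u0 \<union> u1) \<inter> f ` (v0 \<union> v1) = {}"
        using 0 1 by (subst inj_on_image_Int[OF X(2), symmetric]) auto
      fix i V
      assume V: "\<And>y. y \<in> f ` (u0 \<union> u1) \<Longrightarrow> V \<in> y i" "\<And>y. y \<in> f ` (v0 \<union> v1) \<Longrightarrow> V \<notin> y i"
      have "\<forall>a\<in>u0 \<union> u1. first_mono_true (W i) (eta a) (e i -` V)"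
        "\<forall>a\<in>v0 \<union> v1. \<not> first_mono_true (W i) (eta a) (e i -` V)"
        using V(1)[OF imageI] V(2)[OF imageI] unfolding f_def mem_Collect_eq by blast+
      then show False using split[of i] 0(7) 1(8) unfolding splits_at_def by (meson UnI1 UnI2)
    qed (use 0 1 X in auto)
  qed
  show ?thesis unfolding free_caliber_def using f_prod f_card dep by blast
qed

end
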